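(* Let $P=\frac1M\sum_{i=1}^M\delta_{x_i}$ be the uniform probability measure on a finite set $X=\{x_1,\dots,x_M\}\subset\mathbb{S}^2$, and let $n\ge1$. For a configuration $Q=\{q_1,\dots,q_n\}\subset\mathbb{S}^2$, denote $$X_j(Q):=\{x\in X: d_G(x,q_j)\le d_G(x,q_k)\text{ for all }k\},\qquad V_{n,2}(P;Q)=\frac1M\sum_{i=1}^M\min_{1\le j\le n}d_G(x_i,q_j)^2.$$ If $Q^*=\{q_1^*,\dots,q_n^*\}$ is an optimal set of $n$-means for $P$, then with the nearest-neighbor clusters $X_j^*:=X_j(Q^* )$ one has, for each $j$, $$q_j^*\in\arg\min_{q\in\mathbb{S}^2}\sum_{x\in X_j^*}d_G(x,q)^2.$$ In other words, every optimal representative is the intrinsic (Karcher) mean of its own cluster, and the optimal partition is the nearest-neighbor partition.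
   Context: $\mathbb{S}^2$ is the unit sphere in $\mathbb{R}^3$ with geodesic distance $d_G(x,y)=\arccos\langle x,y\rangle$. An optimal set of $n$-means for $P$ is a configuration of at most $n$ points of $\mathbb{S}^2$ minimizing $V_{n,2}(P;Q)$ over all nonempty $Q\subset\mathbb{S}^2$ with $|Q|\le n$. The intrinsic (Karcher) mean of a nonempty finite set $A\subset\mathbb{S}^2$ contained in a geodesic ball of radius less than $\pi/2$ is the unique minimizer over $q\in\mathbb{S}^2$ of $\sum_{x\in A}d_G(x,q)^2$. Whenever the intrinsic mean of a finite set $A$ is invoked, it is assumed that $A$ lies in such a ball; this concerns only the final "in other words" sentence of the claim. *)

theory Defs
  imports "HOL-Probability.Probability"
begin

abbreviation S2 :: "(real ^ 3) set"
  where "S2 \<equiv> sphere 0 1"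

definition geo_dist :: "real ^ 3 \<Rightarrow> real ^ 3 \<Rightarrow> real"
  where "geo_dist x y = arccos (x \<bullet> y)"

(* V_{n,2}(P; Q), for a finite nonempty set Q of representatives. *)
definition distortion :: "(real ^ 3) pmf \<Rightarrow> (real ^ 3) set \<Rightarrow> real"
  where "distortion P Q =
    measure_pmf.expectation P (\<lambda>x. Min ((\<lambda>p. (geo_dist x p)\<^sup>2) ` Q))"

lemma distortion_uniform:
  assumes "finite X" "X \<noteq> {}"
  shows "distortion (pmf_of_set X) Q =
    1 / real (card X) * (\<Sum>x\<in>X. Min ((\<lambda>p. (geo_dist x p)\<^sup>2) ` Q))"
  using assms by (simp add: distortion_def integral_pmf_of_set)

definition configuration :: "nat \<Rightarrow> (real ^ 3) set \<Rightarrow> bool"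
  where "configuration n Q \<longleftrightarrow> Q \<subseteq> S2 \<and> finite Q \<and> Q \<noteq> {} \<and> card Q \<le> n"

definition optimal_n_means :: "(real ^ 3) pmf \<Rightarrow> nat \<Rightarrow> (real ^ 3) set \<Rightarrow> bool"
  where "optimal_n_means P n Q \<longleftrightarrow> is_arg_min (distortion P) (configuration n) Q"

(* Closed Voronoi cluster: a point equidistant from several nearest
   representatives belongs to each of their clusters. *)
definition nn_cluster :: "(real ^ 3) set \<Rightarrow> nat \<Rightarrow> (nat \<Rightarrow> real ^ 3) \<Rightarrow> nat \<Rightarrow> (real ^ 3) set"
  where "nn_cluster X n q j = {x \<in> X. \<forall>k\<in>{1..n}. geo_dist x (q j) \<le> geo_dist x (q k)}"

definition sq_dist_sum :: "(real ^ 3) set \<Rightarrow> real ^ 3 \<Rightarrow> real"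
  where "sq_dist_sum A p = (\<Sum>x\<in>A. (geo_dist x p)\<^sup>2)"

definition in_small_geodesic_ball :: "(real ^ 3) set \<Rightarrow> bool"
  where "in_small_geodesic_ball A \<longleftrightarrow>
    (\<exists>c\<in>S2. \<exists>r < pi / 2. \<forall>x\<in>A. geo_dist c x < r)"

definition is_intrinsic_mean :: "(real ^ 3) set \<Rightarrow> real ^ 3 \<Rightarrow> bool"
  where "is_intrinsic_mean A m \<longleftrightarrow>
    is_arg_min (sq_dist_sum A) (\<lambda>p. p \<in> S2) m \<and>
    (\<forall>p. is_arg_min (sq_dist_sum A) (\<lambda>p. p \<in> S2) p \<longrightarrow> p = m)"

(* Labelled partitions of X into n parts, some of which may be empty. *)
definition labelled_partition :: "(real ^ 3) set \<Rightarrow> nat \<Rightarrow> (nat \<Rightarrow> (real ^ 3) set) \<Rightarrow> bool"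
  where "labelled_partition X n A \<longleftrightarrow>
    (\<Union>j\<in>{1..n}. A j) = X \<and> disjoint_family_on A {1..n}"

(* The mean squared error when the points of A j are represented by q j,
   which need not be their nearest representative. *)
definition clustering_cost ::
    "(real ^ 3) set \<Rightarrow> nat \<Rightarrow> (nat \<Rightarrow> (real ^ 3) set) \<Rightarrow> (nat \<Rightarrow> real ^ 3) \<Rightarrow> real"
  where "clustering_cost X n A q = 1 / real (card X) * (\<Sum>j=1..n. sq_dist_sum (A j) (q j))"

(* The pair (A, q) is optimal among all partitions and representatives jointly. *)
definition optimal_clustering ::
    "(real ^ 3) set \<Rightarrow> nat \<Rightarrow> (nat \<Rightarrow> (real ^ 3) set) \<Rightarrow> (nat \<Rightarrow> real ^ 3) \<Rightarrow> bool"
  where "optimal_clustering X n A q \<longleftrightarrow>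
    is_arg_min (\<lambda>(B, p). clustering_cost X n B p)
      (\<lambda>(B, p). labelled_partition X n B \<and> p ` {1..n} \<subseteq> S2) (A, q)"

end

theory Submission
  imports Defs
begin

text \<open>
  Replacing one representative of an optimal configuration, while the points outside its cluster
  keep their nearest representative, cannot decrease the cost; so each representative minimizes
  the sum of squared distances to its cluster.

  The remaining point is that such a minimizer is unique when the cluster \<open>A\<close> lies in an open
  hemisphere centred at \<open>c\<close>. By reflection, every minimizer lies in that hemisphere.  If \<open>p\<close> and \<open>q\<close>
  were two distinct minimizers, then the gradients of the cost vanish at both.  Kendall's function
  \<open>(1 - p \<bullet> q) / ((c \<bullet> p) * (c \<bullet> q))\<close> strictly decreases when \<open>p\<close> and \<open>q\<close> move along geodesics
  towards a common point of the hemisphere.  Summing its derivative in these directions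
  over the points of \<open>A\<close> gives a negative number, yet the sum is \<open>0\<close> by the vanishing gradients.
\<close>

section \<open>Spherical distance\<close>

lemma abs_inner_sphere_le_1: "x \<in> S2 \<Longrightarrow> y \<in> S2 \<Longrightarrow> \<bar>x \<bullet> y\<bar> \<le> 1"
  using Cauchy_Schwarz_ineq2[of x y] by simp

lemma inner_self_sphere: "x \<in> S2 \<Longrightarrow> x \<bullet> x = 1"
  by (simp add: dot_square_norm)

lemma inner_sphere_eq_1_iff:
  assumes "x \<in> S2" "y \<in> S2"
  shows "x \<bullet> y = 1 \<longleftrightarrow> x = y"
proof
  assume "x \<bullet> y = 1"
  then have "(x - y) \<bullet> (x - y) = 0"
    using assms by (simp add: inner_diff inner_self_sphere inner_commute)
  then show "x = y" by simp
qed (use assms in \<open>simp add: inner_self_sphere\<close>)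

lemma inner_sphere_eq_minus_1_iff:
  assumes "x \<in> S2" "y \<in> S2"
  shows "x \<bullet> y = - 1 \<longleftrightarrow> x = - y"
  using inner_sphere_eq_1_iff[of x "- y"] assms by (simp add: eq_neg_iff_add_eq_0)

lemma geo_dist_nonneg: "x \<in> S2 \<Longrightarrow> y \<in> S2 \<Longrightarrow> 0 \<le> geo_dist x y"
  unfolding geo_dist_def using abs_inner_sphere_le_1[of x y] by (intro arccos_lbound) auto

lemma geo_dist_power2_less:
  assumes "x \<in> S2" "y \<in> S2" "z \<in> S2" "x \<bullet> z < x \<bullet> y"
  shows "(geo_dist x y)\<^sup>2 < (geo_dist x z)\<^sup>2"
proof -
  have "geo_dist x y < geo_dist x z"
    unfolding geo_dist_def
    using assms abs_inner_sphere_le_1 by (subst arccos_less_mono) auto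
  then show ?thesis
    using geo_dist_nonneg assms by (intro power_strict_mono) auto
qed

section \<open>First-order condition for minimizers\<close>

text \<open>With \<open>\<alpha>\<close> the distance of two points and \<open>s = cos \<alpha>\<close>, this is \<open>\<alpha> / sin \<alpha>\<close>, extended by
  continuity to \<open>\<alpha> = 0\<close>.\<close>

definition log_factor :: "real \<Rightarrow> real"
  where "log_factor s = (if s = 1 then 1 else arccos s / sqrt (1 - s\<^sup>2))"

lemma log_factor_cos:
  assumes "0 < \<alpha>" "\<alpha> < pi"
  shows "log_factor (cos \<alpha>) = \<alpha> / sin \<alpha>"
proof -
  have "cos \<alpha> \<noteq> 1"
    using assms cos_monotone_0_pi[of 0 \<alpha>] by auto
  moreover have "sqrt (1 - (cos \<alpha>)\<^sup>2) = sin \<alpha>"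
    using assms by (metis sin_squared_eq sin_gt_zero less_imp_le real_sqrt_unique)
  ultimately show ?thesis
    using assms by (simp add: log_factor_def arccos_cos)
qed

lemma log_factor_ge_1:
  assumes "- 1 < s" "s \<le> 1"
  shows "1 \<le> log_factor s"
proof (cases "s = 1")
  case False
  then have b: "0 < arccos s" "arccos s < pi"
    using assms arccos_lt_bounded[of s] by auto
  then have "sin (arccos s) \<le> arccos s" "0 < sin (arccos s)"
    by (auto intro: sin_x_le_x sin_gt_zero)
  then show ?thesis
    using log_factor_cos[OF b] assms by simp
qed (simp add: log_factor_def)

text \<open>\<open>sin x - x * cos x\<close> vanishes at 0 and has derivative
  \<open>x * sin x\<close>, which is nonnegative up to pi. It is also the numerator of the
  derivative of \<open>x / sin x\<close>.\<close>

lemma x_cos_le_sin: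
  fixes x :: real
  assumes "0 \<le> x" "x \<le> pi"
  shows "x * cos x \<le> sin x"
proof -
  have "sin 0 - 0 * cos 0 \<le> sin x - x * cos x"
  proof (rule DERIV_nonneg_imp_nondecreasing[OF assms(1), where f = "\<lambda>x. sin x - x * cos x"])
    fix t assume t: "0 \<le> t" "t \<le> x"
    have "((\<lambda>x. sin x - x * cos x) has_real_derivative t * sin t) (at t)"
      by (auto intro!: derivative_eq_intros)
    moreover have "0 \<le> t * sin t"
      using t assms by (intro mult_nonneg_nonneg sin_ge_zero) auto
    ultimately show "\<exists>y. ((\<lambda>x. sin x - x * cos x) has_real_derivative y) (at t) \<and> 0 \<le> y"
      by blast
  qed
  then show ?thesis by simp
qed

lemma x_over_sin_mono:
  fixes \<alpha> \<beta> :: real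
  assumes "0 < \<alpha>" "\<alpha> \<le> \<beta>" "\<beta> < pi"
  shows "\<alpha> / sin \<alpha> \<le> \<beta> / sin \<beta>"
proof (rule DERIV_nonneg_imp_nondecreasing[OF assms(2), where f = "\<lambda>x. x / sin x"])
  fix t assume t: "\<alpha> \<le> t" "t \<le> \<beta>"
  then have s: "0 < sin t" using assms by (intro sin_gt_zero) auto
  have "((\<lambda>x. x / sin x) has_real_derivative (sin t - t * cos t) / (sin t * sin t)) (at t)"
    using s by (auto intro!: derivative_eq_intros)
  moreover have "0 \<le> (sin t - t * cos t) / (sin t * sin t)"
    using s x_cos_le_sin[of t] t assms by auto
  ultimately show "\<exists>y. ((\<lambda>x. x / sin x) has_real_derivative y) (at t) \<and> 0 \<le> y"
    by blast
qed

text \<open>A larger inner product means a smaller angle, and \<open>x / sin x\<close> increases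
  with the angle; the value 1 at angle 0 is a lower bound.\<close>

lemma log_factor_antimono:
  assumes "- 1 < s" "s \<le> t" "t \<le> 1"
  shows "log_factor t \<le> log_factor s"
proof (cases "t = 1")
  case True
  then show ?thesis using log_factor_ge_1[of s] assms by (simp add: log_factor_def)
next
  case False
  then have t: "0 < arccos t" and s: "arccos s < pi" and "arccos t \<le> arccos s"
    using assms arccos_lt_bounded[of s] arccos_lt_bounded[of t] arccos_le_arccos[of s t] by auto
  then show ?thesis
    using x_over_sin_mono[of "arccos t" "arccos s"] log_factor_cos[of "arccos t"]
      log_factor_cos[of "arccos s"] assms
    by simp
qed

text \<open>At \<open>x = p\<close> the chain rule fails because arccos is not differentiable at 1,
  but squaring removes the corner: near \<open>t = 0\<close> the function is \<open>t^2\<close>. At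
  \<open>x = - p\<close> a corner would remain.\<close>

lemma geo_dist_power2_deriv:
  assumes "x \<in> S2" "p \<in> S2" "u \<in> S2" "p \<bullet> u = 0" "x \<noteq> - p"
  shows "((\<lambda>t. (geo_dist x (cos t *\<^sub>R p + sin t *\<^sub>R u))\<^sup>2) has_real_derivative
           - 2 * log_factor (x \<bullet> p) * (x \<bullet> u)) (at 0)"
proof (cases "x = p")
  case True
  have "((\<lambda>t::real. t\<^sup>2) has_real_derivative 0) (at 0)"
    by (auto intro!: derivative_eq_intros)
  then have "((\<lambda>t::real. (arccos (cos t))\<^sup>2) has_real_derivative 0) (at 0)"
    by (rule has_field_derivative_transform_within_open[where S = "{-pi<..<pi}"])
      (auto simp: arccos_cos_eq_abs)
  then show ?thesis
    using True assms by (simp add: geo_dist_def inner_add_right inner_self_sphere)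
next
  case False
  have b: "- 1 < x \<bullet> p" "x \<bullet> p < 1"
    using abs_inner_sphere_le_1[of x p] inner_sphere_eq_1_iff[of x p]
      inner_sphere_eq_minus_1_iff[of x p] assms False
    by (simp_all add: less_le abs_le_iff)
  have h: "((\<lambda>t. cos t * (x \<bullet> p) + sin t * (x \<bullet> u)) has_real_derivative x \<bullet> u) (at 0)"
    by (auto intro!: derivative_eq_intros)
  have "((\<lambda>t. arccos (cos t * (x \<bullet> p) + sin t * (x \<bullet> u))) has_real_derivative
      inverse (- sqrt (1 - (x \<bullet> p)\<^sup>2)) * (x \<bullet> u)) (at 0)"
    by (rule DERIV_chain2[OF _ h]) (use DERIV_arccos[OF b] in simp)
  from DERIV_power[OF this, of 2]
  have "((\<lambda>t. (arccos (cos t * (x \<bullet> p) + sin t * (x \<bullet> u)))\<^sup>2) has_real_derivative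
      - 2 * log_factor (x \<bullet> p) * (x \<bullet> u)) (at 0)"
    by (rule DERIV_cong) (use b in \<open>simp add: log_factor_def divide_inverse\<close>)
  then show ?thesis by (simp add: geo_dist_def inner_add_right)
qed

lemma great_circle_in_sphere:
  assumes "p \<in> S2" "u \<in> S2" "p \<bullet> u = 0"
  shows "cos t *\<^sub>R p + sin t *\<^sub>R u \<in> S2"
proof -
  let ?z = "cos t *\<^sub>R p + sin t *\<^sub>R u"
  have "?z \<bullet> ?z = (cos t)\<^sup>2 + (sin t)\<^sup>2"
    using assms
    by (simp add: inner_add inner_self_sphere inner_commute[of u p] power2_eq_square)
  then show ?thesis by (simp add: norm_eq_1)
qed

text \<open>The sum is the inner product of \<open>y\<close> with the sum of the initial velocities of the unit-time
  geodesics from \<open>p\<close> to the points of \<open>A\<close>.\<close>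

lemma minimizer_first_order:
  assumes A: "A \<subseteq> S2"
    and min: "is_arg_min (sq_dist_sum A) (\<lambda>p. p \<in> S2) p"
    and antip: "- p \<notin> A"
  shows "(\<Sum>x\<in>A. log_factor (x \<bullet> p) * (x \<bullet> y - (x \<bullet> p) * (p \<bullet> y))) = 0"
proof -
  have p: "p \<in> S2" and le: "\<And>z. z \<in> S2 \<Longrightarrow> sq_dist_sum A p \<le> sq_dist_sum A z"
    using min by (auto simp: is_arg_min_linorder)
  \<comment> \<open>The component of \<open>y\<close> tangent to the sphere at \<open>p\<close>;
    scaled to length 1 it gives the direction of a great circle through \<open>p\<close>.\<close>
  define w where "w = y - (p \<bullet> y) *\<^sub>R p"
  have xw: "x \<bullet> y - (x \<bullet> p) * (p \<bullet> y) = x \<bullet> w" for x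
    by (simp add: w_def inner_diff_right)
  show ?thesis
  proof (cases "w = 0")
    case True
    then show ?thesis by (simp add: xw)
  next
    case False
    define u where "u = w /\<^sub>R norm w"
    have u: "u \<in> S2" using False by (simp add: u_def)
    have pu: "p \<bullet> u = 0" using p by (simp add: u_def w_def inner_diff_right inner_self_sphere)
    have w: "w = norm w *\<^sub>R u" using False by (simp add: u_def)
    let ?f = "\<lambda>t. sq_dist_sum A (cos t *\<^sub>R p + sin t *\<^sub>R u)"
    have "(?f has_real_derivative (\<Sum>x\<in>A. - 2 * log_factor (x \<bullet> p) * (x \<bullet> u))) (at 0)"
      unfolding sq_dist_sum_def
      using A antip p u pu by (intro DERIV_sum geo_dist_power2_deriv) auto
    \<comment> \<open>\<open>p\<close> is minimal along the whole great circle, so the radius 1 is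
      arbitrary.\<close>
    moreover have "\<forall>t. \<bar>0 - t\<bar> < 1 \<longrightarrow> ?f 0 \<le> ?f t"
      using le great_circle_in_sphere[OF p u pu] by simp
    ultimately have "(\<Sum>x\<in>A. - 2 * log_factor (x \<bullet> p) * (x \<bullet> u)) = 0"
      by (rule DERIV_local_min[OF _ zero_less_one])
    then have "(\<Sum>x\<in>A. log_factor (x \<bullet> p) * (x \<bullet> u)) = 0"
      by (simp add: mult.assoc sum_negf flip: sum_distrib_left)
    then have "norm w * (\<Sum>x\<in>A. log_factor (x \<bullet> p) * (x \<bullet> u)) = 0" by simp
    moreover have "x \<bullet> w = norm w * (x \<bullet> u)" for x by (subst w) simp
    ultimately show ?thesis by (simp add: xw sum_distrib_left mult_ac)
  qed
qed

section \<open>Uniqueness of the intrinsic mean\<close>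

text \<open>If \<open>p\<close> lay strictly beyond the plane orthogonal to \<open>c\<close>, its
  mirror image \<open>r\<close> would be strictly closer to every point of \<open>A\<close>. The
  length of \<open>c\<close> is left free, so that tilted normals are covered too.\<close>

lemma minimizer_inner_nonneg:
  assumes A: "A \<subseteq> S2" "finite A" "A \<noteq> {}"
    and c: "\<And>x. x \<in> A \<Longrightarrow> 0 < c \<bullet> x"
    and min: "is_arg_min (sq_dist_sum A) (\<lambda>p. p \<in> S2) p"
  shows "0 \<le> c \<bullet> p"
proof (rule ccontr)
  assume neg: "\<not> 0 \<le> c \<bullet> p"
  have p: "p \<in> S2" and le: "\<And>z. z \<in> S2 \<Longrightarrow> sq_dist_sum A p \<le> sq_dist_sum A z"
    using min by (auto simp: is_arg_min_linorder)
  have "c \<noteq> 0" using c A by force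
  then have cc: "0 < c \<bullet> c" by simp
  define r where "r = p - (2 * (c \<bullet> p) / (c \<bullet> c)) *\<^sub>R c"
  have "r \<bullet> r = p \<bullet> p"
    using cc unfolding r_def
    by (simp add: inner_diff inner_commute[of p c] field_simps power2_eq_square)
  then have r: "r \<in> S2" using p by (simp add: norm_eq_1)
  have "(geo_dist x r)\<^sup>2 < (geo_dist x p)\<^sup>2" if x: "x \<in> A" for x
  proof (rule geo_dist_power2_less)
    have "2 * (c \<bullet> p) / (c \<bullet> c) < 0"
      using neg cc by (intro divide_neg_pos) auto
    then have "(2 * (c \<bullet> p) / (c \<bullet> c)) * (x \<bullet> c) < 0"
      using c[OF x] by (intro mult_neg_pos) (auto simp: inner_commute)
    then show "x \<bullet> p < x \<bullet> r" by (simp add: r_def inner_diff_right)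
  qed (use x A p r in auto)
  then have "sq_dist_sum A r < sq_dist_sum A p"
    unfolding sq_dist_sum_def using A by (intro sum_strict_mono) auto
  then show False using le[OF r] by simp
qed

text \<open>Reflection fixes the points with \<open>c \<bullet> p = 0\<close>, so it cannot exclude
  them. Finiteness of \<open>A\<close> leaves a margin \<open>m\<close> for tilting the normal,
  which even yields \<open>m / 2 \<le> c \<bullet> p\<close>.\<close>

lemma minimizer_inner_pos:
  assumes A: "A \<subseteq> S2" "finite A" "A \<noteq> {}"
    and c: "\<And>x. x \<in> A \<Longrightarrow> 0 < c \<bullet> x"
    and min: "is_arg_min (sq_dist_sum A) (\<lambda>p. p \<in> S2) p"
  shows "0 < c \<bullet> p"
proof -
  have p: "p \<in> S2" using min by (simp add: is_arg_min_linorder)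
  define m where "m = Min ((\<bullet>) c ` A)"
  have m: "0 < m" "\<And>x. x \<in> A \<Longrightarrow> m \<le> c \<bullet> x"
    using A c by (auto simp: m_def)
  \<comment> \<open>Tilting \<open>c\<close> slightly away from \<open>p\<close> keeps \<open>A\<close> in the hemisphere.\<close>
  have "0 \<le> (c - (m / 2) *\<^sub>R p) \<bullet> p"
  proof (rule minimizer_inner_nonneg[OF A _ min])
    fix x assume x: "x \<in> A"
    then have "p \<bullet> x \<le> 1" using abs_inner_sphere_le_1[of p x] p A by auto
    then have "(m / 2) * (p \<bullet> x) \<le> m / 2"
      using m mult_left_mono[of "p \<bullet> x" 1 "m / 2"] by simp
    then have "0 < c \<bullet> x - (m / 2) * (p \<bullet> x)"
      using m(1) m(2)[OF x] by linarith
    then show "0 < (c - (m / 2) *\<^sub>R p) \<bullet> x"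
      by (simp add: inner_diff_left)
  qed
  then show ?thesis using m p by (simp add: inner_diff_left inner_self_sphere)
qed

text \<open>Read \<open>g\<close>, \<open>a\<close>, \<open>b\<close> as the inner products of the
  pairs p,q and c,p and c,q, and \<open>s\<close>, \<open>t\<close>, \<open>k\<close> as those of x
  with p, q, c. The left side is then minus the logarithmic derivative of Kendall's function as p
  and q move towards x with speeds scaled by \<open>\<phi>\<close> and \<open>\<psi>\<close>. The
  terms of unclear sign cancel, leaving two whose signs can be read off.\<close>

lemma kendall_identity:
  fixes g :: real
  assumes "g \<noteq> 1" "a \<noteq> 0" "b \<noteq> 0"
  shows "(\<phi> * (t - s * g) + \<psi> * (s - t * g)) / (1 - g) + \<phi> * (k - s * a) / a + \<psi> * (k - t * b) / b
    = (\<phi> - \<psi>) * (t - s) / (1 - g) + k * (\<phi> / a + \<psi> / b)"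
proof -
  have "\<phi> * (t - s * g) + \<psi> * (s - t * g) = (\<phi> - \<psi>) * (t - s) + (1 - g) * (\<phi> * s + \<psi> * t)"
    by (simp add: algebra_simps)
  then have "(\<phi> * (t - s * g) + \<psi> * (s - t * g)) / (1 - g)
      = (\<phi> - \<psi>) * (t - s) / (1 - g) + (\<phi> * s + \<psi> * t)"
    using assms by (simp add: add_divide_distrib)
  moreover have "\<phi> * (k - s * a) / a = k * (\<phi> / a) - \<phi> * s" "\<psi> * (k - t * b) / b = k * (\<psi> / b) - \<psi> * t"
    using assms by (simp_all add: field_simps)
  ultimately show ?thesis by (simp add: algebra_simps)
qed

lemma minimizer_unique:
  assumes A: "A \<subseteq> S2" "finite A" "A \<noteq> {}"
    and c: "\<And>x. x \<in> A \<Longrightarrow> 0 < c \<bullet> x"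
    and minp: "is_arg_min (sq_dist_sum A) (\<lambda>p. p \<in> S2) p"
    and minq: "is_arg_min (sq_dist_sum A) (\<lambda>p. p \<in> S2) q"
  shows "p = q"
proof (rule ccontr)
  assume "p \<noteq> q"
  have p: "p \<in> S2" and q: "q \<in> S2" using minp minq by (auto simp: is_arg_min_linorder)
  define a b g where "a = c \<bullet> p" and "b = c \<bullet> q" and "g = p \<bullet> q"
  have a: "0 < a" and b: "0 < b"
    using minimizer_inner_pos[OF A c] minp minq by (auto simp: a_def b_def)
  have g: "g < 1"
    using abs_inner_sphere_le_1[of p q] inner_sphere_eq_1_iff[of p q] p q \<open>p \<noteq> q\<close>
    unfolding g_def by linarith
  \<comment> \<open>Antipodes of the minimizers have negative inner product with \<open>c\<close>,
    so the first-order condition is available at both.\<close>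
  have antip: "- p \<notin> A" "- q \<notin> A"
    using c[of "- p"] c[of "- q"] a b by (auto simp: a_def b_def)
  define \<phi> \<psi> where "\<phi> = (\<lambda>x. log_factor (x \<bullet> p))" and "\<psi> = (\<lambda>x. log_factor (x \<bullet> q))"
  note first_order_p = minimizer_first_order[OF A(1) minp antip(1)]
  note first_order_q = minimizer_first_order[OF A(1) minq antip(2)]
  \<comment> \<open>The conditions at \<open>p\<close> and \<open>q\<close>, each tested against the
    other minimizer and against \<open>c\<close>.\<close>
  have critical: "(\<Sum>x\<in>A. \<phi> x * (x \<bullet> q - (x \<bullet> p) * g)) = 0"
    "(\<Sum>x\<in>A. \<phi> x * (c \<bullet> x - (x \<bullet> p) * a)) = 0"
    "(\<Sum>x\<in>A. \<psi> x * (x \<bullet> p - (x \<bullet> q) * g)) = 0"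
    "(\<Sum>x\<in>A. \<psi> x * (c \<bullet> x - (x \<bullet> q) * b)) = 0"
    using first_order_p[of q] first_order_p[of c] first_order_q[of p] first_order_q[of c]
    by (simp_all add: \<phi>_def \<psi>_def a_def b_def g_def inner_commute)
  \<comment> \<open>This is the left side of \<open>kendall_identity\<close>: positive when
    Kendall's function decreases towards \<open>x\<close>. Its sum over \<open>A\<close> splits into
    the four sums of \<open>critical\<close>.\<close>
  define D where "D x = (\<phi> x * (x \<bullet> q - (x \<bullet> p) * g) + \<psi> x * (x \<bullet> p - (x \<bullet> q) * g)) / (1 - g)
      + \<phi> x * (c \<bullet> x - (x \<bullet> p) * a) / a + \<psi> x * (c \<bullet> x - (x \<bullet> q) * b) / b" for x
  have "(\<Sum>x\<in>A. D x) = 0"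
    unfolding D_def by (simp add: sum.distrib critical flip: sum_divide_distrib)
  moreover have "0 < D x" if x: "x \<in> A" for x
  proof -
    have xp: "- 1 < x \<bullet> p" "x \<bullet> p \<le> 1" and xq: "- 1 < x \<bullet> q" "x \<bullet> q \<le> 1"
      using abs_inner_sphere_le_1[of x p] inner_sphere_eq_minus_1_iff[of x p]
        abs_inner_sphere_le_1[of x q] inner_sphere_eq_minus_1_iff[of x q] x A p q antip
      by (auto simp: less_le abs_le_iff)
    have "0 < \<phi> x" "0 < \<psi> x"
      using log_factor_ge_1 xp xq by (auto simp: \<phi>_def \<psi>_def intro: less_le_trans[OF zero_less_one])
    then have "0 < (c \<bullet> x) * (\<phi> x / a + \<psi> x / b)"
      using a b c[OF x] by (intro mult_pos_pos add_pos_pos divide_pos_pos) auto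
    \<comment> \<open>As \<open>log_factor\<close> is antitone, the two factors never have opposite
      signs.\<close>
    moreover have "0 \<le> (\<phi> x - \<psi> x) * (x \<bullet> q - x \<bullet> p)"
      using log_factor_antimono xp xq unfolding \<phi>_def \<psi>_def
      by (cases "x \<bullet> p \<le> x \<bullet> q") (auto intro: mult_nonneg_nonneg mult_nonpos_nonpos)
    then have "0 \<le> (\<phi> x - \<psi> x) * (x \<bullet> q - x \<bullet> p) / (1 - g)"
      using g by simp
    ultimately show ?thesis
      unfolding D_def using a b g by (subst kendall_identity) auto
  qed
  then have "0 < (\<Sum>x\<in>A. D x)" using A by (intro sum_pos) auto
  ultimately show False by simp
qed

lemma in_small_geodesic_ball_hemisphere:
  assumes "in_small_geodesic_ball A" "A \<subseteq> S2"
  obtains c where "\<And>x. x \<in> A \<Longrightarrow> 0 < c \<bullet> x"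
proof -
  obtain c r where c: "c \<in> S2" "r < pi / 2" "\<And>x. x \<in> A \<Longrightarrow> geo_dist c x < r"
    using assms(1) by (auto simp: in_small_geodesic_ball_def)
  have "0 < c \<bullet> x" if x: "x \<in> A" for x
  proof -
    have "\<bar>c \<bullet> x\<bar> \<le> 1" using abs_inner_sphere_le_1 c x assms by auto
    moreover have "arccos (c \<bullet> x) < arccos 0" using c(2) c(3)[OF x] by (simp add: geo_dist_def)
    ultimately show ?thesis by (subst (asm) arccos_less_mono) auto
  qed
  then show thesis using that by blast
qed

section \<open>Optimal clusterings\<close>

text \<open>Representatives are carried by labels rather than as a set, so repetitions are allowed
  and replacing one of them is a function update.\<close>

definition nearest_sq_dist :: "nat \<Rightarrow> (nat \<Rightarrow> real ^ 3) \<Rightarrow> real ^ 3 \<Rightarrow> real"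
  where "nearest_sq_dist n q x = Min ((\<lambda>p. (geo_dist x p)\<^sup>2) ` q ` {1..n})"

lemma nearest_sq_dist_le: "j \<in> {1..n} \<Longrightarrow> nearest_sq_dist n q x \<le> (geo_dist x (q j))\<^sup>2"
  unfolding nearest_sq_dist_def by (intro Min_le) auto

lemma nearest_sq_dist_eq_iff:
  assumes "x \<in> X" "X \<subseteq> S2" "q ` {1..n} \<subseteq> S2" "j \<in> {1..n}"
  shows "(geo_dist x (q j))\<^sup>2 = nearest_sq_dist n q x \<longleftrightarrow> x \<in> nn_cluster X n q j"
proof -
  have nonneg: "0 \<le> geo_dist x (q k)" if "k \<in> {1..n}" for k
    using assms(1-3) that by (intro geo_dist_nonneg) blast+
  have "(geo_dist x (q j))\<^sup>2 = nearest_sq_dist n q x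
      \<longleftrightarrow> (\<forall>k\<in>{1..n}. (geo_dist x (q j))\<^sup>2 \<le> (geo_dist x (q k))\<^sup>2)"
    unfolding nearest_sq_dist_def using assms(4) by (subst eq_Min_iff) auto
  also have "\<dots> \<longleftrightarrow> x \<in> nn_cluster X n q j"
    using nonneg assms by (auto simp: nn_cluster_def intro: power2_le_imp_le)
  finally show ?thesis .
qed

lemma nn_cluster_cover:
  assumes "n \<ge> 1"
  shows "(\<Union>j\<in>{1..n}. nn_cluster X n q j) = X"
proof
  show "X \<subseteq> (\<Union>j\<in>{1..n}. nn_cluster X n q j)"
  proof
    fix x assume x: "x \<in> X"
    have "\<exists>j. is_arg_min (\<lambda>j. geo_dist x (q j)) (\<lambda>j. j \<in> {1..n}) j"
      using assms ex_is_arg_min_if_finite[of "{1..n}" "\<lambda>j. geo_dist x (q j)"] by auto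
    then obtain j where "j \<in> {1..n}" "\<forall>k\<in>{1..n}. geo_dist x (q j) \<le> geo_dist x (q k)"
      by (auto simp: is_arg_min_linorder)
    then show "x \<in> (\<Union>j\<in>{1..n}. nn_cluster X n q j)"
      using x unfolding nn_cluster_def by blast
  qed
qed (auto simp: nn_cluster_def)

text \<open>A family with repetitions has fewer than \<open>n\<close> distinct points but still is a
  configuration, so every family on the sphere competes with \<open>q\<close>. The common factor
  \<open>1 / card X\<close> cancels.\<close>

lemma optimal_n_means_nearest:
  assumes "finite X" "X \<noteq> {}" "n \<ge> 1" "optimal_n_means (pmf_of_set X) n (q ` {1..n})"
  shows "q ` {1..n} \<subseteq> S2"
    and "p ` {1..n} \<subseteq> S2 \<Longrightarrow>
      (\<Sum>x\<in>X. nearest_sq_dist n q x) \<le> (\<Sum>x\<in>X. nearest_sq_dist n p x)"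
proof -
  show "q ` {1..n} \<subseteq> S2"
    using assms(4) by (simp add: optimal_n_means_def is_arg_min_linorder configuration_def)
  assume "p ` {1..n} \<subseteq> S2"
  then have "configuration n (p ` {1..n})"
    using assms(3) card_image_le[of "{1..n}" p] by (auto simp: configuration_def)
  then have "distortion (pmf_of_set X) (q ` {1..n}) \<le> distortion (pmf_of_set X) (p ` {1..n})"
    using assms(4) by (simp add: optimal_n_means_def is_arg_min_linorder)
  then show "(\<Sum>x\<in>X. nearest_sq_dist n q x) \<le> (\<Sum>x\<in>X. nearest_sq_dist n p x)"
    using assms by (simp add: distortion_uniform nearest_sq_dist_def divide_le_cancel card_gt_0_iff)
qed

lemma representative_minimizes_cluster:
  assumes X: "finite X" "X \<noteq> {}" "X \<subseteq> S2" and n: "n \<ge> 1"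
    and opt: "optimal_n_means (pmf_of_set X) n (q ` {1..n})" and j: "j \<in> {1..n}"
  shows "is_arg_min (sq_dist_sum (nn_cluster X n q j)) (\<lambda>p. p \<in> S2) (q j)"
proof -
  let ?C = "nn_cluster X n q j"
  note q = optimal_n_means_nearest(1)[OF X(1,2) n opt]
  have C: "?C \<subseteq> X" by (auto simp: nn_cluster_def)
  have "sq_dist_sum ?C (q j) \<le> sq_dist_sum ?C p" if p: "p \<in> S2" for p
  proof -
    let ?p = "q(j := p)"
    \<comment> \<open>Such an \<open>x\<close> has a nearest label \<open>k\<close> other than
      \<open>j\<close>, and \<open>q k\<close> survives the replacement.\<close>
    have off: "nearest_sq_dist n ?p x \<le> nearest_sq_dist n q x" if x: "x \<in> X - ?C" for x
    proof -
      obtain k where k: "k \<in> {1..n}" "x \<in> nn_cluster X n q k"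
        using nn_cluster_cover[OF n, of X q] x by blast
      then have "k \<noteq> j" using x by auto
      moreover have "(geo_dist x (q k))\<^sup>2 = nearest_sq_dist n q x"
        using nearest_sq_dist_eq_iff[OF _ X(3) q k(1)] k(2) x by blast
      ultimately show ?thesis
        using nearest_sq_dist_le[OF k(1), of ?p x] by simp
    qed
    have split: "(\<Sum>x\<in>X. f x) = (\<Sum>x\<in>X - ?C. f x) + (\<Sum>x\<in>?C. f x)" for f :: "_ \<Rightarrow> real"
      using sum.subset_diff[OF C X(1)] .
    have "(\<Sum>x\<in>X. nearest_sq_dist n q x) \<le> (\<Sum>x\<in>X. nearest_sq_dist n ?p x)"
      using q p by (intro optimal_n_means_nearest(2)[OF X(1,2) n opt]) auto
    moreover have "(\<Sum>x\<in>X - ?C. nearest_sq_dist n ?p x) \<le> (\<Sum>x\<in>X - ?C. nearest_sq_dist n q x)"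
      using off by (intro sum_mono)
    \<comment> \<open>On the cluster the new minimum is at most the squared distance to
      \<open>p\<close>, while the old one equals that to \<open>q j\<close>, even for points tied
      with another representative.\<close>
    moreover have "(\<Sum>x\<in>?C. nearest_sq_dist n ?p x) \<le> sq_dist_sum ?C p"
      unfolding sq_dist_sum_def using nearest_sq_dist_le[OF j, of ?p] by (intro sum_mono) simp
    moreover have "(\<Sum>x\<in>?C. nearest_sq_dist n q x) = sq_dist_sum ?C (q j)"
      unfolding sq_dist_sum_def
      using C nearest_sq_dist_eq_iff[OF _ X(3) q j] by (intro sum.cong refl) (metis subsetD)
    ultimately show ?thesis
      using split[of "nearest_sq_dist n q"] split[of "nearest_sq_dist n ?p"] by linarith
  qed
  moreover have "q j \<in> S2" using q j by blast
  ultimately show ?thesis by (simp add: is_arg_min_linorder)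
qed

lemma labelled_partition_sum:
  fixes f :: "real ^ 3 \<Rightarrow> real"
  assumes "finite X" "labelled_partition X n A"
  shows "(\<Sum>x\<in>X. f x) = (\<Sum>j=1..n. \<Sum>x\<in>A j. f x)"
proof -
  have X: "X = (\<Union>j\<in>{1..n}. A j)" and disj: "disjoint_family_on A {1..n}"
    using assms(2) by (auto simp: labelled_partition_def)
  have "\<forall>j\<in>{1..n}. finite (A j)"
    using assms(1) X by (auto intro: finite_subset)
  then show ?thesis
    unfolding X using disj by (intro sum.UNION_disjoint) (auto simp: disjoint_family_on_def)
qed

lemma clustering_cost_ge:
  assumes "finite X" "labelled_partition X n A"
  shows "(\<Sum>x\<in>X. nearest_sq_dist n p x) / card X \<le> clustering_cost X n A p"
proof -
  have "(\<Sum>x\<in>X. nearest_sq_dist n p x) \<le> (\<Sum>j=1..n. sq_dist_sum (A j) (p j))"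
    unfolding labelled_partition_sum[OF assms] sq_dist_sum_def
    by (intro sum_mono nearest_sq_dist_le) auto
  then show ?thesis by (simp add: clustering_cost_def divide_right_mono)
qed

text \<open>Up to the factor \<open>1 / card X\<close>, the two costs differ by a sum of nonnegative
  excesses, which vanishes only if every point is assigned to a nearest label.\<close>

lemma clustering_cost_eq_iff:
  assumes X: "finite X" "X \<noteq> {}" "X \<subseteq> S2" and part: "labelled_partition X n A"
    and q: "q ` {1..n} \<subseteq> S2"
  shows "clustering_cost X n A q = (\<Sum>x\<in>X. nearest_sq_dist n q x) / card X
    \<longleftrightarrow> (\<forall>j\<in>{1..n}. A j \<subseteq> nn_cluster X n q j)"
proof -
  have sub: "A j \<subseteq> X" and fin: "finite (A j)" if "j \<in> {1..n}" for j
    using part that X(1) by (auto simp: labelled_partition_def intro: finite_subset)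
  let ?d = "\<lambda>j x. (geo_dist x (q j))\<^sup>2 - nearest_sq_dist n q x"
  have "clustering_cost X n A q = (\<Sum>x\<in>X. nearest_sq_dist n q x) / card X
      \<longleftrightarrow> (\<Sum>j=1..n. sq_dist_sum (A j) (q j)) = (\<Sum>j=1..n. \<Sum>x\<in>A j. nearest_sq_dist n q x)"
    using X by (simp add: clustering_cost_def labelled_partition_sum[OF X(1) part])
  also have "\<dots> \<longleftrightarrow> (\<Sum>j=1..n. \<Sum>x\<in>A j. ?d j x) = 0"
    by (simp add: sq_dist_sum_def sum_subtractf)
  also have "\<dots> \<longleftrightarrow> (\<forall>j\<in>{1..n}. (\<Sum>x\<in>A j. ?d j x) = 0)"
    using nearest_sq_dist_le by (intro sum_nonneg_eq_0_iff) (auto intro!: sum_nonneg)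
  also have "\<dots> \<longleftrightarrow> (\<forall>j\<in>{1..n}. \<forall>x\<in>A j. ?d j x = 0)"
    using nearest_sq_dist_le fin by (intro ball_cong refl sum_nonneg_eq_0_iff) auto
  also have "\<dots> \<longleftrightarrow> (\<forall>j\<in>{1..n}. A j \<subseteq> nn_cluster X n q j)"
    using nearest_sq_dist_eq_iff[OF _ X(3) q] sub by (simp add: subset_iff) blast
  finally show ?thesis .
qed

text \<open>Closed clusters may overlap at ties; choosing one nearest label
  \<open>\<sigma> x\<close> for each point makes them disjoint.\<close>

lemma nearest_partition_exists:
  assumes "n \<ge> 1"
  obtains A where "labelled_partition X n A" "\<And>j. A j \<subseteq> nn_cluster X n q j"
proof -
  have "\<forall>x\<in>X. \<exists>j. j \<in> {1..n} \<and> x \<in> nn_cluster X n q j"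
    using nn_cluster_cover[OF assms, of X q] by blast
  then obtain \<sigma> where "\<forall>x\<in>X. \<sigma> x \<in> {1..n} \<and> x \<in> nn_cluster X n q (\<sigma> x)"
    by metis
  then have "labelled_partition X n (\<lambda>j. {x \<in> X. \<sigma> x = j})"
    "\<And>j. {x \<in> X. \<sigma> x = j} \<subseteq> nn_cluster X n q j"
    by (auto simp: labelled_partition_def disjoint_family_on_def)
  then show thesis by (rule that)
qed

text \<open>The minimal distortion \<open>?m\<close> bounds the cost of every partition with every
  family of representatives from below, and a tie-broken nearest partition with \<open>q\<close>
  attains it. Optimality thus means cost \<open>?m\<close>, which is the equality case
  above.\<close>

lemma optimal_clustering_iff:
  assumes X: "finite X" "X \<noteq> {}" "X \<subseteq> S2" and n: "n \<ge> 1"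
    and opt: "optimal_n_means (pmf_of_set X) n (q ` {1..n})"
    and part: "labelled_partition X n A"
  shows "optimal_clustering X n A q \<longleftrightarrow> (\<forall>j\<in>{1..n}. A j \<subseteq> nn_cluster X n q j)"
proof -
  note q = optimal_n_means_nearest(1)[OF X(1,2) n opt]
  let ?m = "(\<Sum>x\<in>X. nearest_sq_dist n q x) / card X"
  have ge: "?m \<le> clustering_cost X n B p"
    if "labelled_partition X n B" "p ` {1..n} \<subseteq> S2" for B p
  proof -
    have "?m \<le> (\<Sum>x\<in>X. nearest_sq_dist n p x) / card X"
      using optimal_n_means_nearest(2)[OF X(1,2) n opt that(2)] by (simp add: divide_right_mono)
    then show ?thesis using clustering_cost_ge[OF X(1) that(1), of p] by simp
  qed
  obtain B where B: "labelled_partition X n B" "\<And>j. B j \<subseteq> nn_cluster X n q j"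
    using nearest_partition_exists[OF n] by blast
  then have attained: "clustering_cost X n B q = ?m"
    using clustering_cost_eq_iff[OF X B(1) q] by blast
  have "optimal_clustering X n A q \<longleftrightarrow> clustering_cost X n A q = ?m"
  proof
    assume "optimal_clustering X n A q"
    then have "clustering_cost X n A q \<le> clustering_cost X n B q"
      using B(1) q by (auto simp: optimal_clustering_def is_arg_min_linorder)
    then show "clustering_cost X n A q = ?m" using attained ge[OF part q] by simp
  next
    assume "clustering_cost X n A q = ?m"
    then show "optimal_clustering X n A q"
      using ge part q by (auto simp: optimal_clustering_def is_arg_min_linorder)
  qed
  then show ?thesis using clustering_cost_eq_iff[OF X part q] by simp
qed

theorem theorem3p3:
  fixes X :: "(real ^ 3) set" and P :: "(real ^ 3) pmf"
    and n :: nat and q :: "nat \<Rightarrow> real ^ 3"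
  assumes "finite X" and "X \<noteq> {}" and "X \<subseteq> S2"
    and "P = pmf_of_set X"
    and "n \<ge> 1"
    and "optimal_n_means P n (q ` {1..n})"
  shows "(\<forall>j\<in>{1..n}.
            is_arg_min (\<lambda>p. \<Sum>x\<in>nn_cluster X n q j. (geo_dist x p)\<^sup>2) (\<lambda>p. p \<in> S2) (q j))
       \<and> (\<forall>j\<in>{1..n}. nn_cluster X n q j \<noteq> {} \<and> in_small_geodesic_ball (nn_cluster X n q j) \<longrightarrow>
            is_intrinsic_mean (nn_cluster X n q j) (q j))
       \<and> (\<Union>j\<in>{1..n}. nn_cluster X n q j) = X
       \<and> (\<forall>A. labelled_partition X n A \<longrightarrow>
            (optimal_clustering X n A q \<longleftrightarrow> (\<forall>j\<in>{1..n}. A j \<subseteq> nn_cluster X n q j)))"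
proof -
  note X = assms(1-3) and n = assms(5)
  have opt: "optimal_n_means (pmf_of_set X) n (q ` {1..n})" using assms by simp
  have min: "is_arg_min (sq_dist_sum (nn_cluster X n q j)) (\<lambda>p. p \<in> S2) (q j)"
    if "j \<in> {1..n}" for j
    using representative_minimizes_cluster[OF X n opt that] .
  have "is_intrinsic_mean (nn_cluster X n q j) (q j)"
    if j: "j \<in> {1..n}" and "nn_cluster X n q j \<noteq> {}"
      and ball: "in_small_geodesic_ball (nn_cluster X n q j)" for j
  proof -
    have C: "nn_cluster X n q j \<subseteq> S2" "finite (nn_cluster X n q j)"
      using X by (auto simp: nn_cluster_def)
    obtain c where "\<And>x. x \<in> nn_cluster X n q j \<Longrightarrow> 0 < c \<bullet> x"
      using in_small_geodesic_ball_hemisphere[OF ball C(1)] by blast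
    then show ?thesis
      using minimizer_unique[OF C that(2) _ _ min[OF j]] min[OF j]
      by (auto simp: is_intrinsic_mean_def)
  qed
  then show ?thesis
    using min nn_cluster_cover[OF n] optimal_clustering_iff[OF X n opt]
    unfolding sq_dist_sum_def by blast
qed

end
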